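(* Let $l\ge1$, $n\ge1$, $l\le k\le n$ and $m\ge l+n$. Let $\mathcal{D}\subseteq\mathbb{F}_{q^m}^{l+n}$ be a maximum rank distance (MRD) code of dimension $k$ with systematic generator matrix $G=\begin{bmatrix} I & P\end{bmatrix}\in\mathbb{F}_{q^m}^{k\times(l+n)}$, and let $\mathcal{C}_1,\mathcal{C}_2,\psi$ be the nested coset coding scheme built from $\mathcal{D}$ and $G$ as described in the context. Let $t\ge0$, $0\le\rho\le n$ and $N\ge n-\rho$ be integers. Then this scheme is universally $t$-error-$\rho$-erasure-correcting (in the coherent setting) if and only if $2t+\rho<n-k+1$.
   Context: $\mathbb{F}_{q^m}$ is the degree-$m$ extension of the finite field $\mathbb{F}_q$; linear codes are $\mathbb{F}_{q^m}$-subspaces, dimensions are over $\mathbb{F}_{q^m}$. For $x,y\in\mathbb{F}_{q^m}^M$ the rank distance $d_R(x,y)$ is the $\mathbb{F}_q$-dimension of the $\mathbb{F}_q$-span in $\mathbb{F}_{q^m}$ of the coordinates of $y-x$; $d_R(\mathcal{C})$ is the minimum of $d_R(x,0)$ over nonzero $x\in\mathcal{C}$. A linear code $\mathcal{C}\subseteq\mathbb{F}_{q^m}^M$ is MRD if $d_R(\mathcal{C})=\min\{1,m/M\}(M-\dim\mathcal{C})+1$ (so $=M-\dim\mathcal{C}+1$ when $m\ge M$). Construction: write $$G=\begin{bmatrix} I & \Delta G\\ O & G_2\end{bmatrix},$$ with $I$ the $l\times l$ identity, $\Delta G\in\mathbb{F}_{q^m}^{l\times n}$, $G_2\in\mathbb{F}_{q^m}^{(k-l)\times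 n}$. Let $\mathcal{C}_1\subseteq\mathbb{F}_{q^m}^n$ be the punctured code consisting of the last $n$ coordinates of all codewords of $\mathcal{D}$ (generated by the rows of $\Delta G$ and $G_2$), and $\mathcal{C}_2\subseteq\mathcal{C}_1$ the shortened code consisting of the last $n$ coordinates of those codewords of $\mathcal{D}$ whose first $l$ coordinates are zero (generated by the rows of $G_2$). Then $\dim\mathcal{C}_1=k$, $\dim\mathcal{C}_2=k-l$, and $\psi:\mathbb{F}_{q^m}^l\to\mathcal{C}_1/\mathcal{C}_2$, $\psi(S)=S\Delta G+\mathcal{C}_2$, is a linear bijection. A message $S\in\mathbb{F}_{q^m}^l$ is encoded as some $X\in\psi(S)$; the sink receives $Y\in\mathbb{F}_{q^m}^N$ with $Y^{\rm T}=AX^{\rm T}+DZ^{\rm T}$, $A\in\mathbb{F}_q^{N\times n}$, $D\in\mathbb{F}_q^{N\times t}$, $Z\in\mathbb{F}_{q^m}^t$. Universally $t$-error-$\rho$-erasure-correcting in the coherent setting means: for every $A\in\mathbb{F}_q^{N\times n}$ with $\operatorname{rank}A\ge n-\rho$ there are no $S\ne S'$ in $\mathbb{F}_{q^m}^l$, $X\in\psi(S)$, $X'\in\psi(S')$, $D,D'\in\mathbb{F}_q^{N\times t}$, $Z,Z'\in\mathbb{F}_{q^m}^t$ with $AX^{\rm T}+DZ^{\rm T}=AX'^{\rm T}+D'Z'^{\rm T}$ (so $S$ is uniquely determined by $Y$ when $A$ is known). *)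

theory Defs
  imports "Jordan_Normal_Form.DL_Rank"
begin

text \<open>
  The small field \<open>F\<^sub>q\<close> is the type \<open>'q\<close>, the large field \<open>F\<^bsub>q^m\<^esub>\<close> is the type \<open>'e\<close>, and
  \<open>\<iota> :: 'q \<Rightarrow> 'e\<close> is the field embedding, through which \<open>'e\<close> is a vector space over \<open>'q\<close>.
\<close>

definition fq_scale :: "('q::field \<Rightarrow> 'e::field) \<Rightarrow> 'q \<Rightarrow> 'e \<Rightarrow> 'e" where
  "fq_scale \<iota> c x = \<iota> c * x"

lemma vector_space_fq_scale:
  assumes "field_hom \<iota>"
  shows "vector_space (fq_scale \<iota>)"
proof -
  interpret field_hom \<iota> by fact
  show ?thesis
    by standard (auto simp: fq_scale_def algebra_simps hom_distribs)
qed

definition ext_degree :: "('q::field \<Rightarrow> 'e::field) \<Rightarrow> nat" where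
  "ext_degree \<iota> = vector_space.dim (fq_scale \<iota>) (UNIV :: 'e set)"

definition rank_dist :: "('q::field \<Rightarrow> 'e::field) \<Rightarrow> 'e vec \<Rightarrow> 'e vec \<Rightarrow> nat" where
  "rank_dist \<iota> x y =
     vector_space.dim (fq_scale \<iota>) (Modules.module.span (fq_scale \<iota>) (set\<^sub>v (y - x)))"

definition linear_code :: "nat \<Rightarrow> 'e::field vec set \<Rightarrow> bool" where
  "linear_code M C \<longleftrightarrow> VectorSpace.subspace class_ring C (module_vec TYPE('e) M)"

definition code_dim :: "nat \<Rightarrow> 'e::field vec set \<Rightarrow> nat" where
  "code_dim M C = vectorspace.dim class_ring ((module_vec TYPE('e) M)\<lparr>carrier := C\<rparr>)"

text \<open>Unspecified for the zero code, which has no nonzero codeword.\<close>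

definition min_rank_dist :: "('q::field \<Rightarrow> 'e::field) \<Rightarrow> nat \<Rightarrow> 'e vec set \<Rightarrow> nat" where
  "min_rank_dist \<iota> M C = Min {rank_dist \<iota> x (0\<^sub>v M) | x. x \<in> C \<and> x \<noteq> 0\<^sub>v M}"

definition mrd_code :: "('q::field \<Rightarrow> 'e::field) \<Rightarrow> nat \<Rightarrow> 'e vec set \<Rightarrow> bool" where
  "mrd_code \<iota> M C \<longleftrightarrow> linear_code M C \<and>
     real (min_rank_dist \<iota> M C) =
       min 1 (real (ext_degree \<iota>) / real M) * (real M - real (code_dim M C)) + 1"

text \<open>The rows of \<open>G\<close>, in order and without repetition, form a basis of \<open>C\<close>.\<close>

definition generator_matrix :: "nat \<Rightarrow> nat \<Rightarrow> 'e::field mat \<Rightarrow> 'e vec set \<Rightarrow> bool" where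
  "generator_matrix k M G C \<longleftrightarrow> G \<in> carrier_mat k M \<and> distinct (rows G) \<and>
     vectorspace.basis class_ring ((module_vec TYPE('e) M)\<lparr>carrier := C\<rparr>) (set (rows G))"

text \<open>The matrix \<open>[I P]\<close> is written as a block matrix whose lower two blocks have no rows.\<close>

definition systematic :: "nat \<Rightarrow> nat \<Rightarrow> 'e::field mat \<Rightarrow> bool" where
  "systematic k M G \<longleftrightarrow>
     (\<exists>P \<in> carrier_mat k (M - k). G = four_block_mat (1\<^sub>m k) P (0\<^sub>m 0 k) (0\<^sub>m 0 (M - k)))"

definition delta_G :: "nat \<Rightarrow> nat \<Rightarrow> 'e mat \<Rightarrow> 'e mat" where
  "delta_G l n G = mat l n (\<lambda>(i, j). G $$ (i, l + j))"

definition lower_G :: "nat \<Rightarrow> nat \<Rightarrow> nat \<Rightarrow> 'e mat \<Rightarrow> 'e mat" where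
  "lower_G k l n G = mat (k - l) n (\<lambda>(i, j). G $$ (l + i, l + j))"

lemma systematic_block_form:
  fixes G :: "'e::field mat"
  assumes "systematic k (l + n) G" "l \<le> k" "k \<le> n"
  shows "G = four_block_mat (1\<^sub>m l) (delta_G l n G) (0\<^sub>m (k - l) l) (lower_G k l n G)"
proof -
  from assms(1) obtain P where P: "P \<in> carrier_mat k (l + n - k)"
    and G: "G = four_block_mat (1\<^sub>m k) P (0\<^sub>m 0 k) (0\<^sub>m 0 (l + n - k))"
    unfolding systematic_def by blast
  show ?thesis
  proof (rule eq_matI)
    let ?B = "four_block_mat (1\<^sub>m l) (delta_G l n G) (0\<^sub>m (k - l) l) (lower_G k l n G)"
    show "dim_row G = dim_row ?B" and "dim_col G = dim_col ?B"
      using P assms(2,3) by (simp_all add: G delta_G_def lower_G_def)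
    fix i j
    assume "i < dim_row ?B" and "j < dim_col ?B"
    then have i: "i < k" and j: "j < l + n"
      using assms(2) by (simp_all add: delta_G_def lower_G_def)
    have left: "G $$ (i, j) = (if i = j then 1 else 0)" if "j < l"
      using that i assms(2) P by (simp add: G)
    show "G $$ (i, j) = ?B $$ (i, j)"
      using i j left assms(2) by (cases "i < l"; cases "j < l") (simp_all add: delta_G_def lower_G_def)
  qed
qed

definition punctured_code :: "nat \<Rightarrow> 'e vec set \<Rightarrow> 'e vec set" where
  "punctured_code n D = {vec_last x n | x. x \<in> D}"

definition shortened_code :: "nat \<Rightarrow> nat \<Rightarrow> 'e::zero vec set \<Rightarrow> 'e vec set" where
  "shortened_code l n D = {vec_last x n | x. x \<in> D \<and> vec_first x l = 0\<^sub>v l}"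

definition coset :: "'e::plus vec \<Rightarrow> 'e vec set \<Rightarrow> 'e vec set" where
  "coset x C = {x + c | c. c \<in> C}"

definition quotient_code :: "'e::plus vec set \<Rightarrow> 'e vec set \<Rightarrow> 'e vec set set" where
  "quotient_code C1 C2 = {coset x C2 | x. x \<in> C1}"

text \<open>\<open>S \<mapsto> S \<Delta>G + C\<^sub>2\<close>; vectors are columns, so the row vector \<open>S \<Delta>G\<close> is \<open>\<Delta>G\<^sup>T S\<close>.\<close>

definition coset_encoder ::
  "nat \<Rightarrow> nat \<Rightarrow> 'e::field vec set \<Rightarrow> 'e mat \<Rightarrow> 'e vec \<Rightarrow> 'e vec set" where
  "coset_encoder l n D G S = coset ((delta_G l n G)\<^sup>T *\<^sub>v S) (shortened_code l n D)"

text \<open>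
  \<open>\<psi>\<close> maps each message of length \<open>l\<close> to the set of its admissible channel inputs of length \<open>n\<close>;
  \<open>N\<close> is the number of symbols received.
\<close>

definition universally_correcting ::
  "('q::field \<Rightarrow> 'e::field) \<Rightarrow> nat \<Rightarrow> nat \<Rightarrow> nat \<Rightarrow> ('e vec \<Rightarrow> 'e vec set) \<Rightarrow> nat \<Rightarrow> nat \<Rightarrow> bool"
where
  "universally_correcting \<iota> l n N \<psi> t \<rho> \<longleftrightarrow>
     (\<forall>A \<in> carrier_mat N n. vec_space.rank N A \<ge> n - \<rho> \<longrightarrow>
        \<not> (\<exists>S \<in> carrier_vec l. \<exists>S' \<in> carrier_vec l. \<exists>X \<in> \<psi> S. \<exists>X' \<in> \<psi> S'.
             \<exists>D \<in> carrier_mat N t. \<exists>D' \<in> carrier_mat N t.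
             \<exists>Z \<in> carrier_vec t. \<exists>Z' \<in> carrier_vec t.
               S \<noteq> S' \<and>
               map_mat \<iota> A *\<^sub>v X + map_mat \<iota> D *\<^sub>v Z = map_mat \<iota> A *\<^sub>v X' + map_mat \<iota> D' *\<^sub>v Z'))"

lemma coset_encoder_in_quotient:
  fixes G :: "'e::field mat"
  assumes gen: "generator_matrix k (l + n) G D" and code: "linear_code (l + n) D"
    and "l \<le> k" and S: "S \<in> carrier_vec l"
  shows "coset_encoder l n D G S \<in> quotient_code (punctured_code n D) (shortened_code l n D)"
proof -
  interpret V: vec_space "TYPE('e)" "l + n" .
  have G: "G \<in> carrier_mat k (l + n)" and basis: "vectorspace.basis class_ring (V.vs D) (set (rows G))"
    using gen by (auto simp: generator_matrix_def)
  have sub: "VectorSpace.subspace class_ring D V.V"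
    using code by (simp add: linear_code_def)
  have vsD: "vectorspace class_ring (V.vs D)"
    using V.subspace_is_vs[OF sub] .
  have rows: "set (rows G) \<subseteq> D"
    using basis vectorspace.basis_def[OF vsD] by auto
  have "LinearCombinations.module.span class_ring (V.vs D) (set (rows G)) = D"
    using basis vectorspace.basis_def[OF vsD] by auto
  then have rsp: "V.row_space G = D"
    using V.span_li_not_depend(1)[OF rows] sub
    by (simp add: V.row_space_def VectorSpace.subspace_def)
  define x where "x = G\<^sup>T *\<^sub>v (S @\<^sub>v 0\<^sub>v (k - l))"
  have Sk: "S @\<^sub>v 0\<^sub>v (k - l) \<in> carrier_vec k"
    using S \<open>l \<le> k\<close> by (metis append_carrier_vec le_add_diff_inverse zero_carrier_vec)
  have "x \<in> D"
    unfolding rsp[symmetric] V.row_space_eq[OF G] x_def using G Sk by auto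
  moreover have "vec_last x n = (delta_G l n G)\<^sup>T *\<^sub>v S"
  proof (rule eq_vecI)
    fix j assume "j < dim_vec ((delta_G l n G)\<^sup>T *\<^sub>v S)"
    then have j: "j < n" by (simp add: delta_G_def)
    have "vec_last x n $ j = (\<Sum>i = 0..<k. G $$ (i, l + j) * (S @\<^sub>v 0\<^sub>v (k - l)) $ i)"
      using G Sk j S \<open>l \<le> k\<close> by (auto simp: vec_last_def x_def scalar_prod_def)
    also have "\<dots> = (\<Sum>i = 0..<l. G $$ (i, l + j) * S $ i)"
      using S \<open>l \<le> k\<close> by (intro sum.mono_neutral_cong_right) auto
    also have "\<dots> = ((delta_G l n G)\<^sup>T *\<^sub>v S) $ j"
      using j S by (auto simp: delta_G_def scalar_prod_def)
    finally show "vec_last x n $ j = ((delta_G l n G)\<^sup>T *\<^sub>v S) $ j" .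
  qed (simp add: delta_G_def)
  ultimately have "(delta_G l n G)\<^sup>T *\<^sub>v S \<in> punctured_code n D"
    unfolding punctured_code_def by (metis (mono_tags, lifting) mem_Collect_eq)
  then show ?thesis
    unfolding quotient_code_def coset_encoder_def by (intro CollectI exI conjI) (rule refl)
qed

end

theory Submission
  imports Defs "Jordan_Normal_Form.DL_Rank_Submatrix"
begin

text \<open>
  By linearity the scheme fails exactly if some codeword \<open>(S, W)\<close> of \<open>\<D>\<close> with \<open>S \<noteq> 0\<close> admits a
  matrix \<open>A\<close> of rank at least \<open>n - \<rho>\<close> for which \<open>A W\<close> is a sum of two error patterns, each of rank
  weight at most \<open>t\<close>. Applying \<open>A\<close> lowers the rank weight of \<open>W\<close> by at most \<open>\<rho>\<close>, so such a codeword
  has rank weight at most \<open>l + \<rho> + 2t\<close>, which the MRD bound \<open>l + n - k + 1\<close> excludes when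
  \<open>2t + \<rho> \<le> n - k\<close>. Conversely, a \<open>k\<close>-dimensional code contains a nonzero codeword \<open>(S, W)\<close> in which
  the first \<open>k - 1\<close> entries of \<open>W\<close> vanish; its \<open>S\<close> is nonzero because otherwise its rank weight would
  be at most \<open>n - k + 1\<close>. Erasing the last \<open>\<rho>\<close> coordinates leaves at most \<open>n - k + 1 - \<rho> \<le> 2t\<close>
  nonzero entries, which the two error patterns share.
\<close>

section \<open>Rank weight under matrix multiplication\<close>

text \<open>Entries of \<open>B\<close> lie in the small field, so they act as scalars on the
  entries of \<open>Z\<close>. Hence an error pattern driven by \<open>t\<close> packets has all its
  entries in a span with \<open>t\<close> generators, whatever \<open>B\<close> is.\<close>

lemma mult_mat_vec_in_span:
  fixes \<iota> :: "'q::field \<Rightarrow> 'e::field"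
  assumes "field_hom \<iota>" and B: "B \<in> carrier_mat N t" and Z: "Z \<in> carrier_vec t" and "i < N"
  shows "(map_mat \<iota> B *\<^sub>v Z) $ i \<in> Modules.module.span (fq_scale \<iota>) (set\<^sub>v Z)"
proof -
  interpret E: vector_space "fq_scale \<iota>" by (rule vector_space_fq_scale) fact
  have "(map_mat \<iota> B *\<^sub>v Z) $ i = (\<Sum>j = 0..<t. fq_scale \<iota> (B $$ (i, j)) (Z $ j))"
    using assms by (auto simp: scalar_prod_def fq_scale_def)
  also have "\<dots> \<in> E.span (set\<^sub>v Z)"
    using Z by (intro E.span_sum E.span_scale E.span_base) (auto simp: vec_set_def)
  finally show ?thesis .
qed

text \<open>The rank is attained by a maximal independent set of columns. Choosing one index for
  each of them handles repeated columns and gives positions that can also address the entries of a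
  vector multiplied by \<open>A\<close>.\<close>

lemma (in vec_space) rank_eq_card_indpt_cols:
  assumes A: "A \<in> carrier_mat n nc"
  obtains J where "J \<subseteq> {..<nc}" "inj_on (col A) J" "lin_indpt (col A ` J)" "card J = rank A"
proof -
  have "lin_indpt {}"
    by (rule finite_lin_indpt2) auto
  then obtain T where T: "maximal T (\<lambda>T. T \<subseteq> set (cols A) \<and> lin_indpt T)"
    using maximal_exists_superset[of "set (cols A)" "\<lambda>T. T \<subseteq> set (cols A) \<and> lin_indpt T" "{}"]
    by auto
  then have "T \<subseteq> set (cols A)" and li: "lin_indpt T"
    unfolding maximal_def by auto
  then have "T \<subseteq> col A ` {..<nc}"
    using A by (auto simp: cols_def)
  then obtain J where J: "J \<subseteq> {..<nc}" "inj_on (col A) J" "T = col A ` J"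
    by (metis subset_image_inj)
  show ?thesis
    using J li rank_card_indpt[OF A T] by (intro that[of J]) (auto simp: card_image)
qed

text \<open>A maximal independent subset of \<open>U\<close> stays independent when \<open>w\<close>
  is added, so the values 1 at \<open>w\<close> and 0 on that subset extend linearly. This turns a
  question about spans in the large field into scalar equations over the small one.\<close>

lemma separating_functional:
  fixes \<iota> :: "'q::field \<Rightarrow> 'e::field"
  assumes "field_hom \<iota>" and w: "w \<notin> Modules.module.span (fq_scale \<iota>) U"
  obtains g where "Vector_Spaces.linear (fq_scale \<iota>) (*) g" "g w = (1 :: 'q)" "\<And>u. u \<in> U \<Longrightarrow> g u = 0"
proof -
  interpret E: vector_space "fq_scale \<iota>" by (rule vector_space_fq_scale) fact
  interpret P: vector_space_pair "fq_scale \<iota>" "(*) :: 'q \<Rightarrow> 'q \<Rightarrow> 'q"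
    by standard (auto simp: algebra_simps)
  obtain B where B: "B \<subseteq> U" "E.independent B" "U \<subseteq> E.span B"
    using E.maximal_independent_subset by blast
  have w': "w \<notin> E.span B"
    using w E.span_mono[OF B(1)] by auto
  then have "E.independent (insert w B)"
    using B(2) by (rule E.independent_insertI)
  then obtain g where g: "Vector_Spaces.linear (fq_scale \<iota>) (*) g"
      and gB: "\<forall>x\<in>insert w B. g x = (if x = w then 1 else 0 :: 'q)"
    using P.linear_independent_extend[of "insert w B" "\<lambda>x. if x = w then 1 else 0"] by blast
  have "w \<notin> B"
    using w' E.span_base by blast
  with gB have "g x = 0" if "x \<in> B" for x
    using that by auto
  then have "g u = 0" if "u \<in> U" for u
    using P.linear_eq_0_on_span[OF g] B(3) that by blast
  then show ?thesis
    using g gB by (intro that[of g]) auto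
qed

text \<open>\<open>K\<close> holds the entries of \<open>W\<close> at the positions outside a set
  \<open>J\<close> of rank-many independent columns. Since those columns are independent,
  \<open>A W\<close> and \<open>K\<close> determine the entries at \<open>J\<close> by small-field
  linear combinations; a functional replaces the explicit inversion.\<close>

lemma erasure_span:
  fixes \<iota> :: "'q::field \<Rightarrow> 'e::field"
  assumes "field_hom \<iota>" and A: "A \<in> carrier_mat N n" and W: "W \<in> carrier_vec n"
  obtains K where "finite K" "card K \<le> n - vec_space.rank N A"
    "set\<^sub>v W \<subseteq> Modules.module.span (fq_scale \<iota>) (set\<^sub>v (map_mat \<iota> A *\<^sub>v W) \<union> K)"
proof -
  interpret E: vector_space "fq_scale \<iota>" by (rule vector_space_fq_scale) fact
  interpret V: vec_space "TYPE('q)" N .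
  obtain J where J: "J \<subseteq> {..<n}" "inj_on (col A) J" "V.lin_indpt (col A ` J)" "card J = V.rank A"
    using V.rank_eq_card_indpt_cols[OF A] by blast
  have finJ: "finite J"
    using J(1) finite_subset by blast
  let ?AW = "map_mat \<iota> A *\<^sub>v W"
  define K where "K = vec_index W ` ({..<n} - J)"
  have "card K \<le> card ({..<n} - J)"
    unfolding K_def by (rule card_image_le) auto
  also have "\<dots> = n - V.rank A"
    using J(1,4) by (simp add: card_Diff_subset finJ)
  finally have "card K \<le> n - V.rank A" .
  moreover have "set\<^sub>v W \<subseteq> E.span (set\<^sub>v ?AW \<union> K)"
  proof
    fix w assume "w \<in> set\<^sub>v W"
    then obtain i where i: "i < n" "w = W $ i"
      using W by (auto simp: vec_set_def)
    show "w \<in> E.span (set\<^sub>v ?AW \<union> K)"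
    proof (rule ccontr)
      assume nw: "w \<notin> E.span (set\<^sub>v ?AW \<union> K)"
      then obtain g where g: "Vector_Spaces.linear (fq_scale \<iota>) (*) g" "g w = (1 :: 'q)"
        and g0: "\<And>u. u \<in> set\<^sub>v ?AW \<union> K \<Longrightarrow> g u = 0"
        using separating_functional[OF assms(1)] by blast
      interpret g: Vector_Spaces.linear "fq_scale \<iota>" "(*)" g by (rule g(1))
      have "w \<notin> K"
        using g(2) g0[of w] by auto
      then have "i \<in> J"
        using i by (auto simp: K_def)
      \<comment> \<open>The functional turns \<open>A W\<close> into a linear dependency among the columns indexed by \<open>J\<close>.\<close>
      define a where "a c = g (W $ the_inv_into J (col A) c)" for c
      have a: "a (col A j) = g (W $ j)" if "j \<in> J" for j
        using that J(2) by (simp add: a_def the_inv_into_f_f)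
      have "V.lincomb a (col A ` J) = 0\<^sub>v N"
      proof (rule eq_vecI)
        have car: "col A ` J \<subseteq> carrier_vec N"
          using A by auto
        then show "dim_vec (V.lincomb a (col A ` J)) = dim_vec (0\<^sub>v N)"
          using V.lincomb_dim finJ by auto
        fix r assume "r < dim_vec (0\<^sub>v N :: 'q vec)"
        then have r: "r < N" by simp
        have "V.lincomb a (col A ` J) $ r = (\<Sum>j\<in>J. A $$ (r, j) * g (W $ j))"
          unfolding V.lincomb_index[OF r car] sum.reindex[OF J(2)] o_def
          using r A J(1) by (intro sum.cong) (auto simp: a mult.commute)
        \<comment> \<open>Entries of \<open>W\<close> at positions outside \<open>J\<close> belong
          to \<open>K\<close>, where \<open>g\<close> vanishes, so the extra terms are zero.\<close>
        also have "\<dots> = (\<Sum>j = 0..<n. A $$ (r, j) * g (W $ j))"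
          using J(1) by (intro sum.mono_neutral_left) (auto simp: g0 K_def)
        also have "\<dots> = g (\<Sum>j = 0..<n. fq_scale \<iota> (A $$ (r, j)) (W $ j))"
          by (simp add: g.sum g.scale)
        also have "(\<Sum>j = 0..<n. fq_scale \<iota> (A $$ (r, j)) (W $ j)) = ?AW $ r"
          using A W r by (auto simp: scalar_prod_def fq_scale_def)
        also have "g (?AW $ r) = 0"
          using A r by (intro g0) (auto simp: vec_set_def)
        finally show "V.lincomb a (col A ` J) $ r = 0\<^sub>v N $ r"
          using r by simp
      qed
      \<comment> \<open>The dependency is nontrivial: the coefficient of \<open>col A i\<close> is
        \<open>g w = 1\<close>.\<close>
      then have "V.lin_dep (col A ` J)"
        using finJ \<open>i \<in> J\<close> a[of i] g(2) i
        by (intro V.lin_dep_crit[where A = "col A ` J" and a = a and v = "col A i"]) auto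
      with J(3) show False by simp
    qed
  qed
  ultimately show ?thesis
    by (intro that[of K]) (auto simp: K_def)
qed

section \<open>The code and its coset encoder\<close>

lemma generator_matrix_code:
  fixes G :: "'e::field mat"
  assumes gen: "generator_matrix k M G C" and code: "linear_code M C"
  shows "C = {G\<^sup>T *\<^sub>v v | v. v \<in> carrier_vec k}"
proof -
  interpret V: vec_space "TYPE('e)" M .
  have G: "G \<in> carrier_mat k M" and basis: "vectorspace.basis class_ring (V.vs C) (set (rows G))"
    using gen by (auto simp: generator_matrix_def)
  have sub: "VectorSpace.subspace class_ring C V.V"
    using code by (simp add: linear_code_def)
  note basis_def = vectorspace.basis_def[OF V.subspace_is_vs[OF sub]]
  have rows: "set (rows G) \<subseteq> C"
    using basis basis_def by auto
  have "LinearCombinations.module.span class_ring (V.vs C) (set (rows G)) = C"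
    using basis basis_def by auto
  then have "V.row_space G = C"
    using V.span_li_not_depend(1)[OF rows] sub
    by (simp add: V.row_space_def VectorSpace.subspace_def)
  then show ?thesis
    unfolding V.row_space_eq[OF G] using G by auto
qed

lemma systematic_entry:
  assumes "systematic k M G" "k \<le> M" "i < k" "j < k"
  shows "G $$ (i, j) = (if i = j then 1 else 0)"
  using assms unfolding systematic_def by auto

lemma systematic_mult:
  fixes G :: "'e::field mat"
  assumes sys: "systematic k M G" and G: "G \<in> carrier_mat k M" and "k \<le> M"
    and v: "v \<in> carrier_vec k" and j: "j < k"
  shows "(G\<^sup>T *\<^sub>v v) $ j = v $ j"
proof -
  have "(G\<^sup>T *\<^sub>v v) $ j = (\<Sum>i = 0..<k. G $$ (i, j) * v $ i)"
    using G v j \<open>k \<le> M\<close> by (auto simp: scalar_prod_def)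
  also have "\<dots> = (\<Sum>i = 0..<k. if i = j then v $ i else 0)"
    using j systematic_entry[OF sys \<open>k \<le> M\<close>] by (intro sum.cong) auto
  also have "\<dots> = v $ j"
    using j by simp
  finally show ?thesis .
qed

text \<open>The zero padding discards the rows of \<open>G\<close> from \<open>l\<close> on, and the
  identity block copies \<open>S\<close> into the first \<open>l\<close> positions.\<close>

lemma message_codeword:
  fixes G :: "'e::field mat"
  assumes sys: "systematic k (l + n) G" and G: "G \<in> carrier_mat k (l + n)"
    and "l \<le> k" "k \<le> l + n" and S: "S \<in> carrier_vec l"
  shows "G\<^sup>T *\<^sub>v (S @\<^sub>v 0\<^sub>v (k - l)) = S @\<^sub>v ((delta_G l n G)\<^sup>T *\<^sub>v S)"
proof (rule eq_vecI)
  have v: "S @\<^sub>v 0\<^sub>v (k - l) \<in> carrier_vec k"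
    using S \<open>l \<le> k\<close> by (metis append_carrier_vec le_add_diff_inverse zero_carrier_vec)
  show "dim_vec (G\<^sup>T *\<^sub>v (S @\<^sub>v 0\<^sub>v (k - l))) = dim_vec (S @\<^sub>v ((delta_G l n G)\<^sup>T *\<^sub>v S))"
    using G S by (simp add: delta_G_def)
  fix j assume "j < dim_vec (S @\<^sub>v ((delta_G l n G)\<^sup>T *\<^sub>v S))"
  then have j: "j < l + n"
    using S by (simp add: delta_G_def)
  show "(G\<^sup>T *\<^sub>v (S @\<^sub>v 0\<^sub>v (k - l))) $ j = (S @\<^sub>v ((delta_G l n G)\<^sup>T *\<^sub>v S)) $ j"
  proof (cases "j < l")
    case True
    then show ?thesis
      using systematic_mult[OF sys G \<open>k \<le> l + n\<close> v, of j] S \<open>l \<le> k\<close> by (simp add: delta_G_def)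
  next
    case False
    have "(G\<^sup>T *\<^sub>v (S @\<^sub>v 0\<^sub>v (k - l))) $ j = (\<Sum>i = 0..<k. G $$ (i, j) * (S @\<^sub>v 0\<^sub>v (k - l)) $ i)"
      using G v j S \<open>l \<le> k\<close> by (auto simp: scalar_prod_def)
    also have "\<dots> = (\<Sum>i = 0..<l. G $$ (i, j) * S $ i)"
      using S \<open>l \<le> k\<close> by (intro sum.mono_neutral_cong_right) auto
    also have "\<dots> = (S @\<^sub>v ((delta_G l n G)\<^sup>T *\<^sub>v S)) $ j"
      using j S False by (auto simp: delta_G_def scalar_prod_def)
    finally show ?thesis .
  qed
qed

text \<open>Codewords with the same first \<open>l\<close> coordinates differ by a codeword that
  vanishes there, that is, by an element of the shortened code. This eliminates the quotient: both
  directions of the theorem argue about codewords of \<open>D\<close> only.\<close>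

lemma mem_coset_encoder_iff:
  fixes G :: "'e::field mat"
  assumes gen: "generator_matrix k (l + n) G D" and code: "linear_code (l + n) D"
    and sys: "systematic k (l + n) G" and "l \<le> k" "k \<le> l + n" and S: "S \<in> carrier_vec l"
  shows "X \<in> coset_encoder l n D G S \<longleftrightarrow> X \<in> carrier_vec n \<and> S @\<^sub>v X \<in> D"
proof -
  have G: "G \<in> carrier_mat k (l + n)"
    using gen by (simp add: generator_matrix_def)
  note D = generator_matrix_code[OF gen code]
  define P where "P = (delta_G l n G)\<^sup>T *\<^sub>v S"
  define v where "v = S @\<^sub>v 0\<^sub>v (k - l)"
  have v: "v \<in> carrier_vec k"
    unfolding v_def using S \<open>l \<le> k\<close> by (metis append_carrier_vec le_add_diff_inverse zero_carrier_vec)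
  have P: "P \<in> carrier_vec n"
    unfolding P_def by (rule carrier_vecI) (simp add: delta_G_def)
  have Gv: "G\<^sup>T *\<^sub>v v = S @\<^sub>v P"
    unfolding v_def P_def by (rule message_codeword) fact+
  have GT: "G\<^sup>T \<in> carrier_mat (l + n) k"
    using G by simp
  show ?thesis
  proof
    assume "X \<in> coset_encoder l n D G S"
    then obtain x where x: "x \<in> D" "vec_first x l = 0\<^sub>v l" and X: "X = P + vec_last x n"
      by (auto simp: coset_encoder_def coset_def shortened_code_def P_def)
    then obtain u where u: "u \<in> carrier_vec k" "x = G\<^sup>T *\<^sub>v u"
      unfolding D by blast
    have "x \<in> carrier_vec (l + n)"
      using GT u by simp
    then have "x = 0\<^sub>v l @\<^sub>v vec_last x n"
      using vec_first_last_append x(2) by metis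
    then have "S @\<^sub>v X = (S @\<^sub>v P) + x"
      using S P X append_vec_add[of S l "0\<^sub>v l" P n "vec_last x n"] by simp
    also have "\<dots> = G\<^sup>T *\<^sub>v (v + u)"
      using mult_add_distrib_mat_vec[OF GT v u(1)] Gv u by simp
    finally show "X \<in> carrier_vec n \<and> S @\<^sub>v X \<in> D"
      using v u X P unfolding D by auto
  next
    assume X: "X \<in> carrier_vec n \<and> S @\<^sub>v X \<in> D"
    then obtain u where u: "u \<in> carrier_vec k" "S @\<^sub>v X = G\<^sup>T *\<^sub>v u"
      unfolding D by blast
    have "G\<^sup>T *\<^sub>v (u - v) = (S @\<^sub>v X) - (S @\<^sub>v P)"
      using mult_minus_distrib_mat_vec[OF GT u(1) v] Gv u by simp
    also have "\<dots> = 0\<^sub>v l @\<^sub>v (X - P)"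
      using S X P by (intro eq_vecI) auto
    finally have mem: "0\<^sub>v l @\<^sub>v (X - P) \<in> D"
      using u v unfolding D by (metis (mono_tags, lifting) mem_Collect_eq minus_carrier_vec)
    have "vec_first (0\<^sub>v l @\<^sub>v (X - P)) l = 0\<^sub>v l" "vec_last (0\<^sub>v l @\<^sub>v (X - P)) n = X - P"
      using X P by (auto simp: vec_first_def vec_last_def)
    with mem have "X - P \<in> shortened_code l n D"
      unfolding shortened_code_def by (metis (mono_tags, lifting) mem_Collect_eq)
    moreover have "X = P + (X - P)"
      using X P by auto
    ultimately show "X \<in> coset_encoder l n D G S"
      unfolding coset_encoder_def coset_def P_def by blast
  qed
qed

text \<open>A set whose small-field span contains the entries of \<open>c\<close> has at least as
  many elements as the rank weight of \<open>c\<close>. With \<open>M\<close> at most the extension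
  degree, the factor in the MRD condition is 1. An arbitrary spanning set \<open>T\<close> can be
  assembled from several sources.\<close>

lemma mrd_codeword_span:
  fixes \<iota> :: "'q::field \<Rightarrow> 'e::field"
  assumes "field_hom \<iota>" and M: "0 < M" "M \<le> ext_degree \<iota>" and mrd: "mrd_code \<iota> M C"
    and c: "c \<in> C" "c \<noteq> 0\<^sub>v M"
    and T: "finite T" "set\<^sub>v c \<subseteq> Modules.module.span (fq_scale \<iota>) T"
  shows "M + 1 \<le> card T + code_dim M C"
proof -
  interpret E: vector_space "fq_scale \<iota>" by (rule vector_space_fq_scale) fact
  interpret V: vec_space "TYPE('e)" M .
  have carC: "C \<subseteq> carrier_vec M"
    using mrd by (auto simp: mrd_code_def linear_code_def VectorSpace.subspace_def submodule_def)
  have bound: "rank_dist \<iota> x (0\<^sub>v M) \<le> card T'"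
    if x: "x \<in> C" and T': "finite T'" "set\<^sub>v x \<subseteq> E.span T'" for x T'
  proof -
    \<comment> \<open>The distance from \<open>x\<close> to zero is defined through
      \<open>0 - x\<close>, so the entries appear negated.\<close>
    have "set\<^sub>v (0\<^sub>v M - x) \<subseteq> E.span T'"
      using x carC T' by (force simp: vec_set_def intro!: E.span_neg)
    then have "E.span (set\<^sub>v (0\<^sub>v M - x)) \<subseteq> E.span T'"
      by (rule E.span_minimal[OF _ E.subspace_span])
    then show ?thesis
      unfolding rank_dist_def by (rule E.dim_le_card[OF _ T'(1)])
  qed
  let ?R = "{rank_dist \<iota> x (0\<^sub>v M) | x. x \<in> C \<and> x \<noteq> 0\<^sub>v M}"
  \<comment> \<open>The weights are bounded, hence form a finite set, as \<open>Min_le\<close>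
    requires.\<close>
  have "rank_dist \<iota> x (0\<^sub>v M) \<le> M" if "x \<in> C" for x
  proof -
    have "rank_dist \<iota> x (0\<^sub>v M) \<le> card (set\<^sub>v x)"
      using that E.span_superset by (intro bound) (auto simp: vec_set_def)
    also have "\<dots> \<le> M"
      using that carC card_image_le[of "{..<M}" "vec_index x"] by (auto simp: vec_set_def)
    finally show ?thesis .
  qed
  then have "finite ?R"
    by (intro finite_subset[OF _ finite_atMost[of M]]) auto
  then have "min_rank_dist \<iota> M C \<le> rank_dist \<iota> c (0\<^sub>v M)"
    unfolding min_rank_dist_def using c by (intro Min_le) auto
  also have "\<dots> \<le> card T"
    using bound[OF c(1) T] .
  finally have "real (min_rank_dist \<iota> M C) \<le> real (card T)"
    by simp
  moreover have "min 1 (real (ext_degree \<iota>) / real M) = 1"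
    using M by (simp add: min_def)
  ultimately have "real M - real (code_dim M C) + 1 \<le> real (card T)"
    using mrd by (simp add: mrd_code_def)
  then show ?thesis
    by linarith
qed

section \<open>A codeword and errors that defeat the scheme\<close>

text \<open>Fewer than \<open>k\<close> homogeneous linear conditions on \<open>k\<close> unknowns
  have a nonzero solution. The system is padded with zero rows to a square matrix \<open>H\<close>,
  so that the determinant criterion applies.\<close>

lemma codeword_vanishing:
  fixes G :: "'e::field mat"
  assumes G: "G \<in> carrier_mat k M" and "a < k" "b + a \<le> M"
  obtains v where "v \<in> carrier_vec k" "v \<noteq> 0\<^sub>v k" "\<And>i. i < a \<Longrightarrow> (G\<^sup>T *\<^sub>v v) $ (b + i) = 0"
proof -
  define H where "H = mat k k (\<lambda>(i, j). if i < a then G $$ (j, b + i) else 0)"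
  have H: "H \<in> carrier_mat k k"
    by (simp add: H_def)
  \<comment> \<open>Row \<open>a\<close> of \<open>H\<close> is one of the zero rows, so
    \<open>H\<close> is singular.\<close>
  have "H\<^sup>T *\<^sub>v unit_vec k a = 0\<^sub>v k"
    using \<open>a < k\<close> by (intro eq_vecI) (auto simp: H_def)
  moreover have "H\<^sup>T \<in> carrier_mat k k" "unit_vec k a \<in> carrier_vec k" "unit_vec k a \<noteq> (0\<^sub>v k :: 'e vec)"
    using H \<open>a < k\<close> by auto
  ultimately have "det H\<^sup>T = 0"
    using det_0_iff_vec_prod_zero by blast
  then have "det H = 0"
    using det_transpose[OF H] by simp
  then obtain v where v: "v \<in> carrier_vec k" "v \<noteq> 0\<^sub>v k" "H *\<^sub>v v = 0\<^sub>v k"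
    using det_0_iff_vec_prod_zero[OF H] by auto
  have "(G\<^sup>T *\<^sub>v v) $ (b + i) = 0" if "i < a" for i
  proof -
    have "(G\<^sup>T *\<^sub>v v) $ (b + i) = (H *\<^sub>v v) $ i"
      using G v(1) that assms by (auto simp: H_def scalar_prod_def)
    then show ?thesis
      using v that \<open>a < k\<close> by simp
  qed
  with v show ?thesis
    by (intro that[of v]) auto
qed

text \<open>The upper left submatrix of size \<open>r\<close> is the identity, and a nonzero minor
  bounds the rank from below.\<close>

lemma rank_partial_identity:
  assumes "r \<le> N" "r \<le> n"
  shows "r \<le> vec_space.rank N (mat N n (\<lambda>(i, j). if i = j \<and> j < r then 1 else 0 :: 'q::field))"
    (is "_ \<le> vec_space.rank N ?A")
proof -
  have [simp]: "pick {..<r} i = i" if "i < r" for i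
  proof -
    have "{a \<in> {..<r}. a < i} = {..<i}"
      using that by auto
    then show ?thesis
      using pick_card_in_set[of i "{..<r}"] that by simp
  qed
  have sets: "{i. i < N \<and> i \<in> {..<r}} = {..<r}" "{i. i < n \<and> i \<in> {..<r}} = {..<r}"
    using assms by auto
  have "submatrix ?A {..<r} {..<r} = 1\<^sub>m r"
    using assms by (intro eq_matI) (auto simp: submatrix_def sets simp del: lessThan_iff)
  then show ?thesis
    using vec_space.rank_gt_minor[of ?A N n "{..<r}" "{..<r}"] unfolding sets by simp
qed

text \<open>Any values on \<open>t\<close> consecutive positions form an admissible error: a 0-1
  matrix moves the \<open>t\<close> packet symbols into the window. Columns that would reach past
  row \<open>N\<close> are zero.\<close>

lemma window_mult:
  assumes "field_hom \<iota>"
  shows "map_mat \<iota> (mat N t (\<lambda>(i, j). if i = a + j then 1 else 0)) *\<^sub>v vec t (\<lambda>j. f (a + j))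
    = vec N (\<lambda>i. if a \<le> i \<and> i < a + t then f i else 0)" (is "?L = ?R")
proof (rule eq_vecI)
  interpret field_hom \<iota> by fact
  fix i assume "i < dim_vec ?R"
  then have i: "i < N" by simp
  \<comment> \<open>The condition \<open>a \<le> i\<close> guards against truncated
    subtraction.\<close>
  have "?L $ i = (\<Sum>j = 0..<t. if j = i - a \<and> a \<le> i then f i else 0)"
    using i by (auto simp: scalar_prod_def intro!: sum.cong)
  also have "\<dots> = ?R $ i"
    using i by (cases "a \<le> i") auto
  finally show "?L $ i = ?R $ i" .
qed simp

lemma split_errors:
  fixes \<iota> :: "'q::field \<Rightarrow> 'e::field"
  assumes "field_hom \<iota>" and Y: "Y \<in> carrier_vec N"
    and supp: "\<And>i. i < N \<Longrightarrow> \<not> (a \<le> i \<and> i < a + 2 * t) \<Longrightarrow> Y $ i = 0"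
  obtains B B' Z Z' where "B \<in> carrier_mat N t" "B' \<in> carrier_mat N t"
    "Z \<in> carrier_vec t" "Z' \<in> carrier_vec t" "Y + map_mat \<iota> B *\<^sub>v Z = map_mat \<iota> B' *\<^sub>v Z'"
proof -
  let ?B = "\<lambda>a. mat N t (\<lambda>(i, j). if i = a + j then 1 else 0 :: 'q)"
  \<comment> \<open>The first error cancels the first \<open>t\<close> positions of the support, and
    the second reproduces the remaining \<open>t\<close>. Entries of \<open>Y\<close> read beyond
    \<open>N\<close> meet zero columns.\<close>
  have "Y + map_mat \<iota> (?B a) *\<^sub>v vec t (\<lambda>j. - Y $ (a + j))
      = map_mat \<iota> (?B (a + t)) *\<^sub>v vec t (\<lambda>j. Y $ (a + t + j))"
    unfolding window_mult[OF assms(1), of _ _ a "\<lambda>i. - Y $ i"] window_mult[OF assms(1)]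
    using Y supp by (intro eq_vecI) auto
  then show ?thesis
    by (intro that[of "?B a" "?B (a + t)"]) auto
qed

section \<open>Sufficiency of the bound\<close>

lemma universally_correcting_if:
  fixes \<iota> :: "'q::field \<Rightarrow> 'e::field"
  assumes hom: "field_hom \<iota>" and "1 \<le> l" "l \<le> k" "k \<le> n" "l + n \<le> ext_degree \<iota>"
    and mrd: "mrd_code \<iota> (l + n) D" and dim: "code_dim (l + n) D = k"
    and gen: "generator_matrix k (l + n) G D" and sys: "systematic k (l + n) G"
    and small: "2 * t + \<rho> < n - k + 1"
  shows "universally_correcting \<iota> l n N (coset_encoder l n D G) t \<rho>"
  unfolding universally_correcting_def
proof (intro ballI impI notI, elim bexE conjE)
  interpret E: vector_space "fq_scale \<iota>" by (rule vector_space_fq_scale) fact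
  fix A S S' X X' B B' Z Z'
  assume A: "A \<in> carrier_mat N n" and rank: "n - \<rho> \<le> vec_space.rank N A"
    and S: "S \<in> carrier_vec l" "S' \<in> carrier_vec l" "S \<noteq> S'"
    and X: "X \<in> coset_encoder l n D G S" "X' \<in> coset_encoder l n D G S'"
    and B: "B \<in> carrier_mat N t" "B' \<in> carrier_mat N t"
    and Z: "Z \<in> carrier_vec t" "Z' \<in> carrier_vec t"
    and eq: "map_mat \<iota> A *\<^sub>v X + map_mat \<iota> B *\<^sub>v Z = map_mat \<iota> A *\<^sub>v X' + map_mat \<iota> B' *\<^sub>v Z'"
  have code: "linear_code (l + n) D"
    using mrd by (simp add: mrd_code_def)
  have G: "G \<in> carrier_mat k (l + n)"
    using gen by (simp add: generator_matrix_def)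
  note D = generator_matrix_code[OF gen code]
  have "k \<le> l + n"
    using \<open>k \<le> n\<close> by simp
  note enc = mem_coset_encoder_iff[OF gen code sys \<open>l \<le> k\<close> this]
  have Xc: "X \<in> carrier_vec n" "X' \<in> carrier_vec n" "S @\<^sub>v X \<in> D" "S' @\<^sub>v X' \<in> D"
    using X S by (auto simp: enc)
  \<comment> \<open>Two messages explaining the same received word give a nonzero codeword, which
    will be shown to be too light.\<close>
  define c where "c = (S - S') @\<^sub>v (X - X')"
  have c_diff: "c = (S @\<^sub>v X) - (S' @\<^sub>v X')"
    unfolding c_def using S Xc by (intro eq_vecI) auto
  obtain u u' where u: "u \<in> carrier_vec k" "u' \<in> carrier_vec k"
      "S @\<^sub>v X = G\<^sup>T *\<^sub>v u" "S' @\<^sub>v X' = G\<^sup>T *\<^sub>v u'"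
    using Xc(3,4) unfolding D by blast
  have "c = G\<^sup>T *\<^sub>v (u - u')"
    using mult_minus_distrib_mat_vec[of "G\<^sup>T" "l + n" k u u'] G u c_diff by simp
  then have "c \<in> D"
    using u unfolding D by auto
  have "c \<noteq> 0\<^sub>v (l + n)"
  proof
    assume c0: "c = 0\<^sub>v (l + n)"
    have "S $ i = S' $ i" if "i < l" for i
      using arg_cong[OF c0, of "\<lambda>x. x $ i"] that S by (simp add: c_def)
    with S show False
      by (metis carrier_vecD eq_vecI)
  qed
  have XX: "X - X' \<in> carrier_vec n"
    using Xc by simp
  obtain K where K: "finite K" "card K \<le> n - vec_space.rank N A"
    "set\<^sub>v (X - X') \<subseteq> E.span (set\<^sub>v (map_mat \<iota> A *\<^sub>v (X - X')) \<union> K)"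
    using erasure_span[OF hom A XX] by blast
  \<comment> \<open>These generators number at most \<open>l + \<rho> + 2 * t\<close>: the message
    difference, the erased entries and the two error vectors.\<close>
  let ?T = "set\<^sub>v (S - S') \<union> (K \<union> (set\<^sub>v Z \<union> set\<^sub>v Z'))"
  have AX: "set\<^sub>v (map_mat \<iota> A *\<^sub>v (X - X')) \<subseteq> E.span ?T"
  proof
    fix y assume "y \<in> set\<^sub>v (map_mat \<iota> A *\<^sub>v (X - X'))"
    then obtain i where i: "i < N" and y: "y = (map_mat \<iota> A *\<^sub>v (X - X')) $ i"
      using A by (auto simp: vec_set_def)
    have "y = (map_mat \<iota> A *\<^sub>v X) $ i - (map_mat \<iota> A *\<^sub>v X') $ i"
      unfolding y using mult_minus_distrib_mat_vec[of "map_mat \<iota> A" N n X X'] A Xc i by simp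
    also have "\<dots> = (map_mat \<iota> B' *\<^sub>v Z') $ i - (map_mat \<iota> B *\<^sub>v Z) $ i"
    proof -
      have "(map_mat \<iota> A *\<^sub>v X) $ i + (map_mat \<iota> B *\<^sub>v Z) $ i
          = (map_mat \<iota> A *\<^sub>v X + map_mat \<iota> B *\<^sub>v Z) $ i"
        using B i by simp
      also have "\<dots> = (map_mat \<iota> A *\<^sub>v X') $ i + (map_mat \<iota> B' *\<^sub>v Z') $ i"
        unfolding eq using B i by simp
      finally show ?thesis
        by (simp add: algebra_simps)
    qed
    also have "\<dots> \<in> E.span ?T"
      using mult_mat_vec_in_span[OF hom B(1) Z(1) i] mult_mat_vec_in_span[OF hom B(2) Z(2) i]
        E.span_mono[of "set\<^sub>v Z" ?T] E.span_mono[of "set\<^sub>v Z'" ?T]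
      by (intro E.span_diff) blast+
    finally show "y \<in> E.span ?T" .
  qed
  have "K \<subseteq> E.span ?T"
    by (auto intro: E.span_base)
  with AX have "E.span (set\<^sub>v (map_mat \<iota> A *\<^sub>v (X - X')) \<union> K) \<subseteq> E.span ?T"
    by (intro E.span_minimal[OF _ E.subspace_span]) blast
  with K(3) have "set\<^sub>v (X - X') \<subseteq> E.span ?T"
    by blast
  moreover have "set\<^sub>v (S - S') \<subseteq> E.span ?T"
    by (auto intro: E.span_base)
  moreover have "set\<^sub>v c \<subseteq> set\<^sub>v (S - S') \<union> set\<^sub>v (X - X')"
    by (force simp: c_def vec_set_def)
  ultimately have "set\<^sub>v c \<subseteq> E.span ?T"
    by blast
  moreover have "finite ?T"
    using K(1) by (simp add: vec_set_def)
  ultimately have "l + n + 1 \<le> card ?T + k"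
    using mrd_codeword_span[OF hom _ \<open>l + n \<le> ext_degree \<iota>\<close> mrd \<open>c \<in> D\<close> \<open>c \<noteq> 0\<^sub>v (l + n)\<close>] \<open>1 \<le> l\<close> dim
    by simp
  moreover have "card ?T \<le> l + (\<rho> + (t + t))"
  proof -
    have vec_card: "card (set\<^sub>v x) \<le> dim_vec x" for x :: "'e vec"
      using card_image_le[of "{..<dim_vec x}" "vec_index x"] by (simp add: vec_set_def)
    have "card (set\<^sub>v (S - S')) \<le> l" "card (set\<^sub>v Z) \<le> t" "card (set\<^sub>v Z') \<le> t"
      using vec_card[of "S - S'"] vec_card[of Z] vec_card[of Z'] S Z by auto
    moreover have "card K \<le> \<rho>"
      using K(2) rank by linarith
    ultimately show ?thesis
      using card_Un_le[of "set\<^sub>v (S - S')" "K \<union> (set\<^sub>v Z \<union> set\<^sub>v Z')"]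
        card_Un_le[of K "set\<^sub>v Z \<union> set\<^sub>v Z'"] card_Un_le[of "set\<^sub>v Z" "set\<^sub>v Z'"]
      by linarith
  qed
  ultimately show False
    using small \<open>k \<le> n\<close> by linarith
qed

section \<open>Necessity of the bound\<close>

lemma universally_correcting_only_if:
  fixes \<iota> :: "'q::field \<Rightarrow> 'e::field"
  assumes hom: "field_hom \<iota>" and "1 \<le> l" "l \<le> k" "k \<le> n" "l + n \<le> ext_degree \<iota>"
    and mrd: "mrd_code \<iota> (l + n) D" and dim: "code_dim (l + n) D = k"
    and gen: "generator_matrix k (l + n) G D" and sys: "systematic k (l + n) G"
    and "n - \<rho> \<le> N"
    and corr: "universally_correcting \<iota> l n N (coset_encoder l n D G) t \<rho>"
  shows "2 * t + \<rho> < n - k + 1"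
proof (rule ccontr)
  interpret E: vector_space "fq_scale \<iota>" by (rule vector_space_fq_scale) fact
  interpret \<iota>: field_hom \<iota> by fact
  assume "\<not> 2 * t + \<rho> < n - k + 1"
  then have large: "n + 1 \<le> 2 * t + \<rho> + k"
    using \<open>k \<le> n\<close> by linarith
  have code: "linear_code (l + n) D"
    using mrd by (simp add: mrd_code_def)
  have G: "G \<in> carrier_mat k (l + n)"
    using gen by (simp add: generator_matrix_def)
  note D = generator_matrix_code[OF gen code]
  have kln: "k \<le> l + n"
    using \<open>k \<le> n\<close> by simp
  note enc = mem_coset_encoder_iff[OF gen code sys \<open>l \<le> k\<close> kln]
  \<comment> \<open>With \<open>k\<close> unknowns, \<open>k - 1\<close> vanishing entries can be
    imposed; they are placed directly after the \<open>l\<close> message positions.\<close>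
  have "k - 1 < k" "l + (k - 1) \<le> l + n"
    using assms(2-4) by linarith+
  then obtain v where v: "v \<in> carrier_vec k" "v \<noteq> 0\<^sub>v k"
    and van: "\<And>i. i < k - 1 \<Longrightarrow> (G\<^sup>T *\<^sub>v v) $ (l + i) = 0"
    using codeword_vanishing[OF G] by blast
  define c where "c = G\<^sup>T *\<^sub>v v"
  have c: "c \<in> carrier_vec (l + n)" "c \<in> D"
    using G v unfolding D by (auto simp: c_def)
  have c0: "c \<noteq> 0\<^sub>v (l + n)"
  proof
    assume c_zero: "c = 0\<^sub>v (l + n)"
    have "v $ i = 0" if "i < k" for i
      using systematic_mult[OF sys G kln v(1) that] c_zero that kln by (simp add: c_def[symmetric])
    with v show False
      by (metis carrier_vecD eq_vecI index_zero_vec)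
  qed
  define S where "S = vec_first c l"
  define W where "W = vec_last c n"
  have S: "S \<in> carrier_vec l" and W: "W \<in> carrier_vec n" and cSW: "S @\<^sub>v W = c"
    using c by (auto simp: S_def W_def)
  have W0: "W $ i = 0" if "i < k - 1" for i
    using van[OF that, folded c_def] carrier_vecD[OF c(1)] that \<open>k \<le> n\<close>
    by (simp add: W_def vec_last_def)
  \<comment> \<open>Otherwise the entries of \<open>c\<close> would be spanned by the last
    \<open>n - k + 1\<close> entries of \<open>W\<close>, below the MRD bound
    \<open>l + n - k + 1\<close> because \<open>1 \<le> l\<close>.\<close>
  have "S \<noteq> 0\<^sub>v l"
  proof
    assume S0: "S = 0\<^sub>v l"
    let ?T = "vec_index W ` {k - 1..<n}"
    have "set\<^sub>v c \<subseteq> E.span ?T"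
    proof
      fix x assume "x \<in> set\<^sub>v c"
      then obtain i where i: "i < l + n" "x = (S @\<^sub>v W) $ i"
        using c cSW by (auto simp: vec_set_def)
      show "x \<in> E.span ?T"
      proof (cases "l + (k - 1) \<le> i")
        case True
        then have "x = W $ (i - l)" "i - l \<in> {k - 1..<n}"
          using i S W by auto
        then have "x \<in> ?T"
          by (rule image_eqI)
        then show ?thesis
          by (rule E.span_base)
      next
        case False
        then have "x = 0"
          using i S W S0 W0 by auto
        then show ?thesis
          by (simp add: E.span_zero)
      qed
    qed
    then have "l + n + 1 \<le> card ?T + k"
      using mrd_codeword_span[OF hom _ \<open>l + n \<le> ext_degree \<iota>\<close> mrd c(2) c0] \<open>1 \<le> l\<close> dim by simp
    moreover have "card ?T \<le> n - (k - 1)"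
      using card_image_le[of "{k - 1..<n}" "vec_index W"] by simp
    ultimately show False
      using \<open>1 \<le> l\<close> \<open>l \<le> k\<close> \<open>k \<le> n\<close> by linarith
  qed
  \<comment> \<open>This channel delivers the first \<open>n - \<rho>\<close> coordinates and erases
    the rest; any further rows are zero.\<close>
  define A where "A = mat N n (\<lambda>(i, j). if i = j \<and> j < n - \<rho> then 1 else 0 :: 'q)"
  have A: "A \<in> carrier_mat N n"
    by (simp add: A_def)
  have rank: "n - \<rho> \<le> vec_space.rank N A"
    unfolding A_def using \<open>n - \<rho> \<le> N\<close> by (intro rank_partial_identity) auto
  define Y where "Y = map_mat \<iota> A *\<^sub>v W"
  have Y_index: "Y $ i = (if i < n - \<rho> then W $ i else 0)" if "i < N" for i
  proof -
    have "Y $ i = (\<Sum>j = 0..<n. \<iota> (if i = j \<and> j < n - \<rho> then 1 else 0) * W $ j)"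
      using W that by (simp add: Y_def A_def scalar_prod_def)
    also have "\<dots> = (\<Sum>j = 0..<n. if j = i then (if i < n - \<rho> then W $ i else 0) else 0)"
      by (intro sum.cong) auto
    finally have "Y $ i = (\<Sum>j = 0..<n. if j = i then (if i < n - \<rho> then W $ i else 0) else 0)" .
    then show ?thesis
      by auto
  qed
  have "Y \<in> carrier_vec N"
    using A W by (simp add: Y_def)
  \<comment> \<open>The support of \<open>Y\<close> starts at \<open>k - 1\<close> and ends before
    \<open>n - \<rho>\<close>, which \<open>large\<close> bounds by
    \<open>k - 1 + 2 * t\<close>.\<close>
  moreover have "Y $ i = 0" if "i < N" "\<not> (k - 1 \<le> i \<and> i < k - 1 + 2 * t)" for i
    using that large W0 by (auto simp: Y_index)
  ultimately obtain B B' Z Z' where B: "B \<in> carrier_mat N t" "B' \<in> carrier_mat N t"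
    and Z: "Z \<in> carrier_vec t" "Z' \<in> carrier_vec t"
    and eq: "Y + map_mat \<iota> B *\<^sub>v Z = map_mat \<iota> B' *\<^sub>v Z'"
    using split_errors[OF hom, of Y N "k - 1" t] by blast
  have "map_mat \<iota> A *\<^sub>v 0\<^sub>v n + map_mat \<iota> B' *\<^sub>v Z' = map_mat \<iota> B' *\<^sub>v Z'"
    using A B by (intro eq_vecI) auto
  with eq have "map_mat \<iota> A *\<^sub>v W + map_mat \<iota> B *\<^sub>v Z = map_mat \<iota> A *\<^sub>v 0\<^sub>v n + map_mat \<iota> B' *\<^sub>v Z'"
    by (simp add: Y_def)
  moreover have "W \<in> coset_encoder l n D G S"
    using S W c cSW by (simp add: enc)
  \<comment> \<open>The competing message is zero, sent as the zero vector; it is confused with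
    \<open>S\<close>, sent as \<open>W\<close>.\<close>
  moreover have "0\<^sub>v n \<in> coset_encoder l n D G (0\<^sub>v l)"
  proof -
    have "0\<^sub>v l @\<^sub>v 0\<^sub>v n = G\<^sup>T *\<^sub>v 0\<^sub>v k"
      using G by (intro eq_vecI) auto
    then have "0\<^sub>v l @\<^sub>v 0\<^sub>v n \<in> D"
      unfolding D using zero_carrier_vec by blast
    then show ?thesis
      using enc[OF zero_carrier_vec] by simp
  qed
  ultimately show False
    using corr A rank S B Z \<open>S \<noteq> 0\<^sub>v l\<close> zero_carrier_vec unfolding universally_correcting_def
    by blast
qed

theorem proposition48:
  fixes \<iota> :: "'q::{field,finite} \<Rightarrow> 'e::{field,finite}"
    and l n k m t \<rho> N :: nat
    and D :: "'e vec set"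
    and G :: "'e mat"
  assumes "field_hom \<iota>"
    and "m = ext_degree \<iota>"
    and "1 \<le> l" and "1 \<le> n" and "l \<le> k" and "k \<le> n" and "l + n \<le> m"
    and "mrd_code \<iota> (l + n) D"
    and "code_dim (l + n) D = k"
    and "generator_matrix k (l + n) G D"
    and "systematic k (l + n) G"
    and "\<rho> \<le> n" and "n - \<rho> \<le> N"
  shows "universally_correcting \<iota> l n N (coset_encoder l n D G) t \<rho> \<longleftrightarrow> 2 * t + \<rho> < n - k + 1"
  using universally_correcting_if universally_correcting_only_if assms by blast

end
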